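(* Let $\mathbb{B}$ be a complete Boolean algebra and $U$ an ultrafilter on $\mathbb{B}$. The two presentations of the Boolean ultrapower of the universe are isomorphic. Specifically, there is an isomorphism $\pi:V^{\downarrow\mathbb{B}}_U\cong\check V_U$ such that $\pi\circ j=j_U$, where $j:V\to V^{\downarrow\mathbb{B}}_U$ is the canonical embedding of the functional presentation and $j_U:V\to\check V_U$ is the Boolean ultrapower map of the name presentation.
   Context: Name presentation. $\mathbb{B}$-names (elements of $V^{\mathbb{B}}$) are defined recursively: $\tau$ is a $\mathbb{B}$-name if $\tau$ is a set of pairs $\langle\sigma,b\rangle$ with $\sigma$ a $\mathbb{B}$-name and $b\in\mathbb{B}$. Boolean values: $[\![\tau\in\sigma]\!]=\bigvee_{\langle\eta,b\rangle\in\sigma}[\![\tau=\eta]\!]\wedge b$, $[\![\tau=\sigma]\!]=[\![\tau\subseteq\sigma]\!]\wedge[\![\sigma\subseteq\tau]\!]$, $[\![\tau\subseteq\sigma]\!]=\bigwedge_{\eta\in\mathrm{dom}(\tau)}(\neg[\![\eta\in\tau]\!]\vee[\![\eta\in\sigma]\!])$. For $x\in V$, $\check x=\{\langle\check y,1\rangle : y\in x\}$; $[\![\tau\in\check V]\!]=\bigvee_{x\in V}[\![\tau=\check x]\!]$. Let $\tau=_U\sigma$ iff $[\![\tau=\sigma]\!]\in U$, $\tau\in_U\sigma$ iff $[\![\tau\in\sigma]\!]\in U$; $[\tau]_U$ is the $=_U$-class of $\tau$ (restricted to members of minimal rank). $\check V_U=\{[\tau]_U : [\![\tau\in\check V]\!]\in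 U\}$ under $\in_U$, and $j_U(x)=[\check x]_U$. Functional presentation. A spanning function is a function $f:A\to V$ whose domain $A$ is a maximal antichain in $\mathbb{B}$ (functions and antichains taken in $V$); $V^{\downarrow\mathbb{B}}$ is the collection of all of them. A maximal antichain $B$ refines $A$ if every $b\in B$ is below some (necessarily unique) $a\in A$; then the reduction $f\downarrow B:B\to V$ is $(f\downarrow B)(b)=f(a)$ for $b\leq a$. For spanning functions $f:A\to V$, $g:B\to V$ and any common refinement $C$ of $A$ and $B$, let $f\equiv_U g$ iff $\bigvee\{c\in C : (f\downarrow C)(c)=(g\downarrow C)(c)\}\in U$, and $f\in_U g$ iff $\bigvee\{c\in C : (f\downarrow C)(c)\in(g\downarrow C)(c)\}\in U$ (independent of the choice of $C$). $V^{\downarrow\mathbb{B}}_U$ is the structure of $\equiv_U$-equivalence classes $[f]_U$ with the relation induced by $\in_U$, and $j(x)=[c_x]_U$, where $c_x$ is the constant function with domain the maximal antichain $\{1\}$ and value $x$. *)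

theory Defs
  imports "HOL-Library.Multiset"
begin

section \<open>The universe of sets\<close>

text \<open>
  A type of this class is a universe of sets: \<open>x \<in> elts y\<close> is the membership relation of the
  universe. HOL sets and functions over the type play the role of classes and class functions, and
  Separation and Replacement are stated for all of them.
\<close>

class zfc_universe =
  fixes elts :: "'a \<Rightarrow> 'a set"
  assumes extensionality: "elts x = elts y \<Longrightarrow> x = y"
    and foundation: "elts x \<noteq> {} \<Longrightarrow> \<exists>z\<in>elts x. elts z \<inter> elts x = {}"
    and pairing: "\<exists>z. elts z = {x, y}"
    and union: "\<exists>z. elts z = (\<Union>y\<in>elts x. elts y)"
    and power_set: "\<exists>z. elts z = {w. elts w \<subseteq> elts x}"
    and infinity: "\<exists>x. (\<exists>e\<in>elts x. elts e = {}) \<and>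
                       (\<forall>y\<in>elts x. \<exists>s\<in>elts x. elts s = insert y (elts y))"
    and separation: "\<exists>z. elts z = {w \<in> elts x. P w}"
    and replacement: "\<exists>z. elts z = F ` elts x"
    and choice: "(\<forall>y\<in>elts x. elts y \<noteq> {}) \<Longrightarrow>
                 (\<forall>y\<in>elts x. \<forall>y'\<in>elts x. y \<noteq> y' \<longrightarrow> elts y \<inter> elts y' = {}) \<Longrightarrow>
                 \<exists>c. \<forall>y\<in>elts x. \<exists>!w. w \<in> elts c \<inter> elts y"

definition small :: "'v::zfc_universe set \<Rightarrow> bool" where
  "small X \<longleftrightarrow> (\<exists>z. elts z = X)"

definition vset :: "'v::zfc_universe set \<Rightarrow> 'v" where
  "vset X = (THE z. elts z = X)"

definition vpair :: "'v::zfc_universe \<Rightarrow> 'v \<Rightarrow> 'v" where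
  "vpair x y = vset {vset {x}, vset {x, y}}"

lemma elts_vset: "elts (vset X) = X" if "small X"
  unfolding vset_def
  by (rule theI') (use that extensionality in \<open>auto simp: small_def\<close>)

lemma small_elts [simp]: "small (elts x)"
  by (auto simp: small_def)

lemma vset_elts [simp]: "vset (elts x) = x"
  by (rule extensionality) (simp add: elts_vset)

lemma small_insert2 [simp]: "small {x, y}"
  using pairing by (auto simp: small_def)

lemma small_insert1 [simp]: "small {x}"
  using small_insert2[of x x] by simp

lemma small_image: "small (F ` X)" if "small X" for F :: "'v::zfc_universe \<Rightarrow> 'v"
proof -
  from that obtain x where "elts x = X" by (auto simp: small_def)
  then show ?thesis using replacement[of F x] by (simp add: small_def)
qed

lemma small_subset: "small Y" if "small X" "Y \<subseteq> X"
proof -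
  from that obtain x where "elts x = X" by (auto simp: small_def)
  with that have "{w \<in> elts x. w \<in> Y} = Y" by auto
  then show ?thesis using separation[of x "\<lambda>w. w \<in> Y"] by (simp add: small_def)
qed

lemma small_UN: "small (\<Union>y\<in>elts x. elts (F y))" for F :: "'v::zfc_universe \<Rightarrow> 'v"
proof -
  obtain z where "elts z = F ` elts x" using replacement[of F x] ..
  then show ?thesis using union[of z] by (simp add: small_def)
qed

lemma small_insert [simp]: "small (insert x (elts y))"
proof -
  obtain p where "elts p = {vset {x}, y}" using pairing[of "vset {x}" y] ..
  then have "insert x (elts y) = (\<Union>z\<in>elts p. elts z)" by (simp add: elts_vset)
  then show ?thesis using union[of p] by (simp add: small_def)
qed

lemma elts_vpair: "elts (vpair x y) = {vset {x}, vset {x, y}}"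
  by (simp add: vpair_def elts_vset)

lemma vpair_inject [simp]: "vpair x y = vpair x' y' \<longleftrightarrow> x = x' \<and> y = y'"
proof
  assume "vpair x y = vpair x' y'"
  then have "elts ` elts (vpair x y) = elts ` elts (vpair x' y')" by simp
  then have "{{x}, {x, y}} = {{x'}, {x', y'}}" by (simp add: elts_vpair elts_vset)
  then show "x = x' \<and> y = y'" by (auto simp: doubleton_eq_iff)
qed simp

definition vmem :: "('v::zfc_universe \<times> 'v) set" where
  "vmem = {(x, y). x \<in> elts y}"

primrec vnum :: "nat \<Rightarrow> 'v::zfc_universe" where
  "vnum 0 = vset {}"
| "vnum (Suc n) = vset (insert (vnum n) (elts (vnum n)))"

lemma wf_vmem: "wf (vmem :: ('v::zfc_universe \<times> 'v) set)"
proof (rule ccontr)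
  assume "\<not> wf (vmem :: ('v \<times> 'v) set)"
  then obtain s :: "nat \<Rightarrow> 'v" where s: "\<And>n. s (Suc n) \<in> elts (s n)"
    by (auto simp: wf_iff_no_infinite_down_chain vmem_def)
  obtain I e :: 'v where e: "e \<in> elts I" "elts e = {}"
    and I: "\<forall>y\<in>elts I. \<exists>s\<in>elts I. elts s = insert y (elts y)"
    using infinity by blast
  define N where "N = (vnum :: nat \<Rightarrow> 'v)"
  have N0: "N 0 = e"
    using vset_elts[of e] e by (simp add: N_def)
  have NI: "N n \<in> elts I" for n
  proof (induction n)
    case 0 then show ?case using N0 e by simp
  next
    case (Suc n)
    then obtain t where "t \<in> elts I" "elts t = insert (N n) (elts (N n))" using I by blast
    then have "N (Suc n) = t" using vset_elts[of t] by (simp add: N_def)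
    then show ?case using \<open>t \<in> elts I\<close> by simp
  qed
  have NS: "elts (N (Suc n)) = insert (N n) (elts (N n))" for n
    by (simp add: N_def elts_vset)
  have irrefl: "x \<notin> elts x" for x :: 'v
    using foundation[of "vset {x}"] by (auto simp: elts_vset)
  have mono: "N m \<in> elts (N n)" if "m < n" for m n
    using that by (induction n) (auto simp: NS less_Suc_eq)
  have inj: "inj N"
    by (rule linorder_injI) (metis irrefl mono)
  have "small (range N)"
    by (rule small_subset[OF small_elts[of I]]) (use NI in auto)
  then have "small ((\<lambda>x. s (inv N x)) ` range N)" by (rule small_image)
  moreover have "(\<lambda>x. s (inv N x)) ` range N = range s"
    using inj by (simp add: image_image)
  ultimately obtain r where r: "elts r = range s" by (auto simp: small_def)
  then obtain n where "elts (s n) \<inter> range s = {}" using foundation[of r] by auto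
  then show False using s[of n] by auto
qed


section \<open>Complete Boolean algebras in the universe\<close>

text \<open>
  The sort \<open>{boolean_algebra, complete_lattice}\<close> is used rather than the class
  \<open>complete_boolean_algebra\<close>, which demands complete distributivity and therefore only has
  atomic algebras as instances.

  That the algebra is a set in \<open>V\<close> is expressed by \<open>coded enc\<close>: the elements of the algebra
  are (identified, through \<open>enc\<close>, with) the elements of a set of the universe. By Separation
  every subset of the algebra is then in \<open>V\<close> as well, so that completeness in \<open>V\<close> is completeness.
\<close>

definition coded :: "('b \<Rightarrow> 'v::zfc_universe) \<Rightarrow> bool" where
  "coded enc \<longleftrightarrow> inj enc \<and> small (range enc)"

definition ultrafilter :: "'b::boolean_algebra set \<Rightarrow> bool" where
  "ultrafilter U \<longleftrightarrow>
     top \<in> U \<and> bot \<notin> U \<and>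
     (\<forall>a\<in>U. \<forall>b\<in>U. inf a b \<in> U) \<and>
     (\<forall>a\<in>U. \<forall>b. a \<le> b \<longrightarrow> b \<in> U) \<and>
     (\<forall>a. a \<in> U \<or> - a \<in> U)"

definition isomorphism ::
    "('a \<Rightarrow> 'c) \<Rightarrow> 'a set \<times> ('a \<Rightarrow> 'a \<Rightarrow> bool) \<Rightarrow> 'c set \<times> ('c \<Rightarrow> 'c \<Rightarrow> bool) \<Rightarrow> bool" where
  "isomorphism \<pi> M N \<longleftrightarrow>
     bij_betw \<pi> (fst M) (fst N) \<and>
     (\<forall>x\<in>fst M. \<forall>y\<in>fst M. snd M x y \<longleftrightarrow> snd N (\<pi> x) (\<pi> y))"


section \<open>The name presentation\<close>

context
  fixes enc :: "'b::{boolean_algebra, complete_lattice} \<Rightarrow> 'v::zfc_universe"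
begin

inductive is_name :: "'v \<Rightarrow> bool" where
  "(\<And>p. p \<in> elts \<tau> \<Longrightarrow> \<exists>\<sigma> b. p = vpair \<sigma> (enc b) \<and> is_name \<sigma>) \<Longrightarrow> is_name \<tau>"

definition name_entries :: "'v \<Rightarrow> ('v \<times> 'b) set" where
  "name_entries \<tau> = {(\<eta>, b). vpair \<eta> (enc b) \<in> elts \<tau>}"

definition name_dom :: "'v \<Rightarrow> 'v set" where
  "name_dom \<tau> = fst ` name_entries \<tau>"

end

lemma vpair_fst_trancl: "(\<eta>, \<tau>) \<in> vmem\<^sup>+" if "vpair \<eta> c \<in> elts \<tau>"
proof -
  have "(\<eta>, vset {\<eta>}) \<in> vmem" "(vset {\<eta>}, vpair \<eta> c) \<in> vmem" "(vpair \<eta> c, \<tau>) \<in> vmem"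
    using that by (simp_all add: vmem_def elts_vpair elts_vset)
  then show ?thesis by (meson r_into_trancl trancl_into_trancl)
qed

text \<open>
  Termination of the simultaneous recursion for the Boolean values: each call gets a multiset of
  tagged arguments, where a tagged argument \<open>(\<tau>, 1)\<close> exceeds \<open>(\<tau>, 0)\<close>, which exceeds
  \<open>(\<eta>, 1)\<close> for \<open>\<eta> \<in> name_dom enc \<tau>\<close>.
\<close>

definition tag_order :: "(('v::zfc_universe \<times> nat) \<times> ('v \<times> nat)) set" where
  "tag_order = vmem\<^sup>+ <*lex*> less_than"

fun call_measure ::
    "('v \<times> 'v) + ('v \<times> 'v) + ('v \<times> 'v) \<Rightarrow> ('v \<times> nat) multiset \<times> nat" where
  "call_measure (Inl (\<eta>, \<tau>)) = ({#(\<eta>, 1), (\<tau>, 0)#}, 0)"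
| "call_measure (Inr (Inl (\<tau>, \<sigma>))) = ({#(\<tau>, 1), (\<sigma>, 1)#}, 1)"
| "call_measure (Inr (Inr (\<tau>, \<sigma>))) = ({#(\<tau>, 1), (\<sigma>, 1)#}, 0)"

lemma tag_orderI: "(\<eta>, \<tau>) \<in> vmem\<^sup>+ \<Longrightarrow> ((\<eta>, i), (\<tau>, j)) \<in> tag_order"
  by (simp add: tag_order_def)

lemma tag_orderI': "((\<tau>, 0), (\<tau>, Suc 0)) \<in> tag_order"
  by (simp add: tag_order_def)

lemma wf_tag_order: "wf tag_order"
  unfolding tag_order_def by (intro wf_lex_prod wf_trancl wf_vmem wf_less_than)

lemma mult_two_one:
  assumes "(a, c) \<in> tag_order" "(b, c) \<in> tag_order"
  shows "({#a, b#}, {#c, d#}) \<in> mult tag_order"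
proof -
  have 1: "({#a, b#}, {#c#}) \<in> mult tag_order"
    using one_step_implies_mult[of "{#c#}" "{#a, b#}" tag_order "{#}"] assms by auto
  have 2: "({#c#}, {#c, d#}) \<in> mult tag_order"
    using one_step_implies_mult[of "{#d#}" "{#}" tag_order "{#c#}"] by (simp add: add_mset_commute)
  show ?thesis
    using 1 2 unfolding mult_def by (rule trancl_trans)
qed

lemma mult_two_two:
  assumes "(a, c) \<in> tag_order" "(b, d) \<in> tag_order"
  shows "({#a, b#}, {#c, d#}) \<in> mult tag_order"
  using one_step_implies_mult[of "{#c, d#}" "{#a, b#}" tag_order "{#}"] assms by auto

lemma mult_second:
  assumes "(b, d) \<in> tag_order"
  shows "({#a, b#}, {#a, d#}) \<in> mult tag_order"
  using one_step_implies_mult[of "{#d#}" "{#b#}" tag_order "{#a#}"] assms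
  by (simp add: add_mset_commute)

context
  fixes enc :: "'b::{boolean_algebra, complete_lattice} \<Rightarrow> 'v::zfc_universe"
begin

function val_mem :: "'v \<Rightarrow> 'v \<Rightarrow> 'b"
  and val_eq :: "'v \<Rightarrow> 'v \<Rightarrow> 'b"
  and val_sub :: "'v \<Rightarrow> 'v \<Rightarrow> 'b" where
  "val_mem \<tau> \<sigma> = (SUP (\<eta>, b)\<in>name_entries enc \<sigma>. inf (val_eq \<tau> \<eta>) b)"
| "val_eq \<tau> \<sigma> = inf (val_sub \<tau> \<sigma>) (val_sub \<sigma> \<tau>)"
| "val_sub \<tau> \<sigma> = (INF \<eta>\<in>name_dom enc \<tau>. sup (- val_mem \<eta> \<tau>) (val_mem \<eta> \<sigma>))"
  by pat_completeness auto
termination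
proof (relation "inv_image (mult tag_order <*lex*> less_than) call_measure")
  show "wf (inv_image (mult tag_order <*lex*> less_than) call_measure)"
    by (intro wf_inv_image wf_lex_prod wf_mult wf_tag_order wf_less_than)
next
  fix \<tau> \<sigma> :: 'v and x :: "'v \<times> 'b" and \<eta> b
  assume "x \<in> name_entries enc \<sigma>" "(\<eta>, b) = x"
  then show "(Inr (Inl (\<tau>, \<eta>)), Inl (\<tau>, \<sigma>))
      \<in> inv_image (mult tag_order <*lex*> less_than) call_measure"
    by (auto simp: name_entries_def intro!: mult_second tag_orderI intro: vpair_fst_trancl)
next
  fix \<tau> \<sigma> :: 'v
  show "(Inr (Inr (\<tau>, \<sigma>)), Inr (Inl (\<tau>, \<sigma>)))
      \<in> inv_image (mult tag_order <*lex*> less_than) call_measure"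
    by simp
next
  fix \<tau> \<sigma> :: 'v
  show "(Inr (Inr (\<sigma>, \<tau>)), Inr (Inl (\<tau>, \<sigma>)))
      \<in> inv_image (mult tag_order <*lex*> less_than) call_measure"
    by (simp add: add_mset_commute)
next
  fix \<tau> \<sigma> \<eta> :: 'v
  assume "\<eta> \<in> name_dom enc \<tau>"
  then have *: "(\<eta>, \<tau>) \<in> vmem\<^sup>+"
    by (auto simp: name_dom_def name_entries_def intro: vpair_fst_trancl)
  show "(Inl (\<eta>, \<tau>), Inr (Inr (\<tau>, \<sigma>)))
      \<in> inv_image (mult tag_order <*lex*> less_than) call_measure"
    using * by (auto intro!: mult_two_one tag_orderI tag_orderI')
  show "(Inl (\<eta>, \<sigma>), Inr (Inr (\<tau>, \<sigma>)))
      \<in> inv_image (mult tag_order <*lex*> less_than) call_measure"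
    using * by (auto intro!: mult_two_two tag_orderI tag_orderI')
qed

text \<open>These equations loop as simplification rules.\<close>

declare val_mem.simps [simp del] val_eq.simps [simp del] val_sub.simps [simp del]

function check :: "'v \<Rightarrow> 'v" where
  "check x = vset ((\<lambda>y. vpair (check y) (enc top)) ` elts x)"
  by pat_completeness auto
termination
  by (relation vmem, rule wf_vmem, simp add: vmem_def)

declare check.simps [simp del]

definition val_in_ground :: "'v \<Rightarrow> 'b" where
  "val_in_ground \<tau> = (SUP x. val_eq \<tau> (check x))"

definition name_eq :: "'b set \<Rightarrow> 'v \<Rightarrow> 'v \<Rightarrow> bool" where
  "name_eq U \<tau> \<sigma> \<longleftrightarrow> val_eq \<tau> \<sigma> \<in> U"

definition name_mem :: "'b set \<Rightarrow> 'v \<Rightarrow> 'v \<Rightarrow> bool" where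
  "name_mem U \<tau> \<sigma> \<longleftrightarrow> val_mem \<tau> \<sigma> \<in> U"

end

text \<open>The von Neumann rank, as an ordinal of the universe; ordinals are compared by inclusion.\<close>

function rank :: "'v::zfc_universe \<Rightarrow> 'v" where
  "rank x = vset (\<Union>y\<in>elts x. insert (rank y) (elts (rank y)))"
  by pat_completeness auto
termination
  by (relation vmem, rule wf_vmem, simp_all add: vmem_def)

declare rank.simps [simp del]

lemma elts_check: "elts (check enc x) = (\<lambda>y. vpair (check enc y) (enc top)) ` elts x"
  by (subst check.simps) (simp add: elts_vset small_image)

lemma elts_rank: "elts (rank x) = (\<Union>y\<in>elts x. insert (rank y) (elts (rank y)))"
proof -
  have "small (\<Union>y\<in>elts x. insert (rank y) (elts (rank y)))"
    using small_UN[of "\<lambda>y. vset (insert (rank y) (elts (rank y)))" x]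
    by (simp only: elts_vset small_insert)
  then show ?thesis by (simp only: rank.simps[of x] elts_vset)
qed

context
  fixes enc :: "'b::{boolean_algebra, complete_lattice} \<Rightarrow> 'v::zfc_universe"
    and U :: "'b set"
begin

definition name_class :: "'v \<Rightarrow> 'v set" where
  "name_class \<tau> =
     {\<sigma>. is_name enc \<sigma> \<and> name_eq enc U \<sigma> \<tau> \<and>
         (\<forall>\<sigma>'. is_name enc \<sigma>' \<and> name_eq enc U \<sigma>' \<tau> \<longrightarrow> elts (rank \<sigma>) \<subseteq> elts (rank \<sigma>'))}"

definition name_ultrapower :: "'v set set \<times> ('v set \<Rightarrow> 'v set \<Rightarrow> bool)" where
  "name_ultrapower =
     (name_class ` {\<tau>. is_name enc \<tau> \<and> val_in_ground enc \<tau> \<in> U},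
      \<lambda>X Y. \<exists>\<tau>\<in>X. \<exists>\<sigma>\<in>Y. name_mem enc U \<tau> \<sigma>)"

definition name_embedding :: "'v \<Rightarrow> 'v set" where
  "name_embedding x = name_class (check enc x)"

end


section \<open>The functional presentation\<close>

definition antichain :: "'b::boolean_algebra set \<Rightarrow> bool" where
  "antichain A \<longleftrightarrow> bot \<notin> A \<and> (\<forall>a\<in>A. \<forall>b\<in>A. a \<noteq> b \<longrightarrow> inf a b = bot)"

definition maximal_antichain :: "'b::boolean_algebra set \<Rightarrow> bool" where
  "maximal_antichain A \<longleftrightarrow> antichain A \<and> (\<forall>A'. antichain A' \<and> A \<subseteq> A' \<longrightarrow> A' = A)"

definition refines :: "'b::boolean_algebra set \<Rightarrow> 'b set \<Rightarrow> bool" where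
  "refines B A \<longleftrightarrow> maximal_antichain B \<and> maximal_antichain A \<and> (\<forall>b\<in>B. \<exists>a\<in>A. b \<le> a)"

text \<open>
  A function \<open>f : A \<rightarrow> V\<close> with \<open>A\<close> a subset of the algebra is a partial map with domain
  \<open>dom f = A\<close>. All of these are in \<open>V\<close>, see lemma \<open>small_graph\<close>.
\<close>

definition spanning :: "('b::boolean_algebra \<rightharpoonup> 'v::zfc_universe) \<Rightarrow> bool" where
  "spanning f \<longleftrightarrow> maximal_antichain (dom f)"

lemma small_graph:
  assumes "coded enc"
  shows "small {vpair (enc a) x | a x. f a = Some x}"
proof -
  have "small (enc ` dom f)"
    using assms by (auto simp: coded_def intro: small_subset)
  then have "small ((\<lambda>z. vpair z (the (f (inv enc z)))) ` enc ` dom f)"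
    by (rule small_image)
  also have "(\<lambda>z. vpair z (the (f (inv enc z)))) ` enc ` dom f
      = {vpair (enc a) x | a x. f a = Some x}"
  proof -
    have "inv enc (enc a) = a" for a using assms by (simp add: coded_def)
    then show ?thesis by (auto simp: image_image image_iff dom_def) (metis option.sel)
  qed
  finally show ?thesis .
qed

definition reduction :: "('b::boolean_algebra \<rightharpoonup> 'v) \<Rightarrow> 'b set \<Rightarrow> ('b \<rightharpoonup> 'v)" where
  "reduction f B = (\<lambda>b. if b \<in> B then f (THE a. a \<in> dom f \<and> b \<le> a) else None)"

text \<open>
  The Boolean values below do not depend on the common refinement \<open>C\<close>, and \<open>f\<close> and \<open>g\<close> always
  have one when they are spanning, so the quantifier over \<open>C\<close> could equally be universal. The
  applications of \<open>the\<close> only ever meet defined values, because \<open>reduction f C\<close> has domain \<open>C\<close>.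
\<close>

definition func_eq ::
    "'b::{boolean_algebra, complete_lattice} set \<Rightarrow> ('b \<rightharpoonup> 'v::zfc_universe) \<Rightarrow> ('b \<rightharpoonup> 'v) \<Rightarrow> bool" where
  "func_eq U f g \<longleftrightarrow>
     (\<exists>C. refines C (dom f) \<and> refines C (dom g) \<and>
          Sup {c \<in> C. the (reduction f C c) = the (reduction g C c)} \<in> U)"

definition func_mem ::
    "'b::{boolean_algebra, complete_lattice} set \<Rightarrow> ('b \<rightharpoonup> 'v::zfc_universe) \<Rightarrow> ('b \<rightharpoonup> 'v) \<Rightarrow> bool" where
  "func_mem U f g \<longleftrightarrow>
     (\<exists>C. refines C (dom f) \<and> refines C (dom g) \<and>
          Sup {c \<in> C. the (reduction f C c) \<in> elts (the (reduction g C c))} \<in> U)"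

context
  fixes U :: "'b::{boolean_algebra, complete_lattice} set"
begin

definition func_class :: "('b \<rightharpoonup> 'v::zfc_universe) \<Rightarrow> ('b \<rightharpoonup> 'v) set" where
  "func_class f = {g. spanning g \<and> func_eq U g f}"

definition func_ultrapower ::
    "('b \<rightharpoonup> 'v::zfc_universe) set set \<times> (('b \<rightharpoonup> 'v) set \<Rightarrow> ('b \<rightharpoonup> 'v) set \<Rightarrow> bool)" where
  "func_ultrapower =
     (func_class ` {f. spanning f}, \<lambda>X Y. \<exists>f\<in>X. \<exists>g\<in>Y. func_mem U f g)"

definition func_embedding :: "'v::zfc_universe \<Rightarrow> ('b \<rightharpoonup> 'v) set" where
  "func_embedding x = func_class [top \<mapsto> x]"

end

end

theory Submission
  imports Defs
begin

text \<open>
  A spanning function \<open>f\<close> is a recipe for a name that takes the ground-model value \<open>f a\<close> with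
  Boolean value at least \<open>a\<close>. Such a name can be written down directly: the entries of \<open>mixture enc f\<close>
  are the pairs of the check name of \<open>y\<close> with \<open>a\<close>, for \<open>y\<close> in \<open>f a\<close>. Below \<open>a\<close> no other member of
  the antichain matters, so there the mixture has the same members as the check name of \<open>f a\<close>
  (lemma \<open>le_val_eq_mixture_check\<close>). The isomorphism sends the class of \<open>f\<close> to the class of its
  mixture.

  Three facts make this work.

  \<^item> Boolean equality is a congruence (\<open>val_eq_trans\<close>, \<open>val_mem_cong\<close>) and check names decide equality
    and membership absolutely, with values \<open>top\<close> and \<open>bot\<close> (\<open>val_eq_check\<close>, \<open>val_mem_check\<close>). Cutting
    the Boolean value of \<open>mixture f R mixture g\<close> into the pieces \<open>inf a b\<close>, with \<open>a\<close> and \<open>b\<close> from the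
    two antichains, leaves exactly those pieces on which \<open>R (f a) (g b)\<close> holds. Their supremum is
    \<open>func_val R f g\<close>.

  \<^item> The same supremum arises from every common refinement of the two antichains
    (\<open>Sup_refinement_eq_func_val\<close>). So equality and membership in the functional presentation are those
    of the mixtures, which makes the map well defined, injective and an embedding.

  \<^item> If a name \<open>\<tau>\<close> is in the ground model with value \<open>d\<close> in \<open>U\<close>, the values of \<open>\<tau> = check x\<close>, for varying
    \<open>x\<close>, are pairwise disjoint with supremum \<open>d\<close>. Completed by the complement of \<open>d\<close> they form a
    partition of \<open>top\<close>, hence the domain of a spanning function, whose mixture equals \<open>\<tau>\<close> with value at
    least \<open>d\<close> (\<open>val_in_ground_le_val_eq_mixture\<close>). This is surjectivity.

  Since classes of names keep only members of minimal rank, they determine the equality of names only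
  if they are nonempty. This holds because ranks are linearly ordered (\<open>rank_linear\<close>).
\<close>

section \<open>Suprema and maximal antichains in a complete Boolean algebra\<close>

text \<open>
  The half of the distributive law \<open>inf (Sup B) a = (SUP b\<in>B. inf b a)\<close> that has content. It holds in
  every complete Boolean algebra because \<open>inf _ a\<close> has the right adjoint \<open>sup (- a)\<close>.
\<close>

lemma inf_Sup_le:
  fixes c :: "'b::{boolean_algebra, complete_lattice}"
  assumes "\<And>b. b \<in> B \<Longrightarrow> inf b a \<le> c"
  shows "inf (Sup B) a \<le> c"
proof -
  have "Sup B \<le> sup (- a) c"
    by (rule Sup_least) (use assms in \<open>simp add: shunt1\<close>)
  then show ?thesis by (simp add: shunt1)
qed

lemma inf_SUP_le:
  fixes c :: "'b::{boolean_algebra, complete_lattice}"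
  assumes "\<And>i. i \<in> I \<Longrightarrow> inf (F i) a \<le> c"
  shows "inf (SUP i\<in>I. F i) a \<le> c"
  by (rule inf_Sup_le) (use assms in auto)

text \<open>
  A nonzero complement of the supremum could be added to the antichain.
\<close>

lemma maximal_antichain_Sup:
  fixes A :: "'b::{boolean_algebra, complete_lattice} set"
  assumes "maximal_antichain A"
  shows "Sup A = top"
proof (rule ccontr)
  assume "Sup A \<noteq> top"
  then have "- Sup A \<noteq> bot"
    by (metis compl_bot_eq double_compl)
  moreover have disj: "inf a (- Sup A) = bot" if "a \<in> A" for a
    using Sup_upper[OF that] by (metis inf_shunt double_compl)
  ultimately have "antichain (insert (- Sup A) A)"
    using assms by (auto simp: maximal_antichain_def antichain_def inf_commute)
  then have "- Sup A \<in> A"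
    using assms by (auto simp: maximal_antichain_def)
  then show False
    using disj[of "- Sup A"] \<open>- Sup A \<noteq> bot\<close> by simp
qed

lemma maximal_antichainI:
  fixes A :: "'b::{boolean_algebra, complete_lattice} set"
  assumes "antichain A" "Sup A = top"
  shows "maximal_antichain A"
  unfolding maximal_antichain_def
proof (intro conjI allI impI assms(1))
  fix A' assume A': "antichain A' \<and> A \<subseteq> A'"
  have "c \<in> A" if "c \<in> A'" for c
  proof (rule ccontr)
    assume "c \<notin> A"
    have "inf (Sup A) c \<le> bot"
    proof (rule inf_Sup_le)
      fix a assume "a \<in> A"
      then show "inf a c \<le> bot"
        using A' that \<open>c \<notin> A\<close> by (metis antichain_def order_refl subset_iff)
    qed
    then show False
      using A' that assms(2) by (auto simp: antichain_def bot_unique)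
  qed
  then show "A' = A" using A' by auto
qed

text \<open>
  Inequalities may be checked separately below each member of a maximal antichain. This is how every
  Boolean value involving a spanning function is computed below.
\<close>

lemma maximal_antichain_cases_le:
  fixes p :: "'b::{boolean_algebra, complete_lattice}"
  assumes "maximal_antichain A" "\<And>a. a \<in> A \<Longrightarrow> inf a p \<le> q"
  shows "p \<le> q"
  using inf_Sup_le[of A p q] assms maximal_antichain_Sup[of A] by simp

lemma refines_part_le:
  assumes "refines C A" "c \<in> C" "a \<in> A" "inf c a \<noteq> bot"
  shows "c \<le> a"
proof -
  obtain a' where a': "a' \<in> A" "c \<le> a'"
    using assms(1,2) by (auto simp: refines_def)
  then have "inf a' a \<noteq> bot"
    using assms(4) by (metis inf_mono order_refl bot_unique)
  then show ?thesis
    using a' assms(1,3) by (auto simp: refines_def maximal_antichain_def antichain_def)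
qed

lemma reduction_eq:
  assumes "refines C (dom f)" "c \<in> C" "a \<in> dom f" "c \<le> a"
  shows "reduction f C c = f a"
proof -
  have ac: "antichain (dom f)" and "c \<noteq> bot"
    using assms(1,2) by (auto simp: refines_def maximal_antichain_def antichain_def)
  have unique: "a' = a" if "a' \<in> dom f" "c \<le> a'" for a'
  proof (rule ccontr)
    assume "a' \<noteq> a"
    then have "inf a' a = bot" using ac that(1) assms(3) by (simp add: antichain_def)
    then show False
      using le_infI[OF that(2) assms(4)] \<open>c \<noteq> bot\<close> by (simp add: bot_unique)
  qed
  have "(THE a'. a' \<in> dom f \<and> c \<le> a') = a"
    by (rule the_equality) (use assms(3,4) unique in blast)+
  then show ?thesis using assms(2) by (simp add: reduction_def)
qed

text \<open>
  The nonzero meets of members of the two antichains form the coarsest common refinement.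
\<close>

lemma common_refinement:
  fixes A B :: "'b::{boolean_algebra, complete_lattice} set"
  assumes A: "maximal_antichain A" and B: "maximal_antichain B"
  shows "\<exists>C. refines C A \<and> refines C B"
proof -
  define C where "C = {inf a b | a b. a \<in> A \<and> b \<in> B \<and> inf a b \<noteq> bot}"
  have "antichain C"
    unfolding antichain_def
  proof (intro conjI ballI impI)
    show "bot \<notin> C" by (auto simp: C_def)
    fix c d assume "c \<in> C" "d \<in> C" "c \<noteq> d"
    then obtain a b a' b' where ab: "c = inf a b" "d = inf a' b'" "a \<in> A" "a' \<in> A" "b \<in> B" "b' \<in> B"
      by (auto simp: C_def)
    have "inf c d = inf (inf a a') (inf b b')"
      using ab by (simp add: ac_simps)
    moreover have "inf a a' = bot \<or> inf b b' = bot"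
      using A B ab \<open>c \<noteq> d\<close> by (metis antichain_def maximal_antichain_def)
    ultimately show "inf c d = bot" by auto
  qed
  moreover have "top \<le> Sup C"
  proof (rule maximal_antichain_cases_le[OF A], rule maximal_antichain_cases_le[OF B])
    fix a b assume "a \<in> A" "b \<in> B"
    then have "inf b a \<le> Sup C"
      by (cases "inf b a = bot") (auto simp: C_def inf_commute intro!: Sup_upper)
    then show "inf b (inf a top) \<le> Sup C" by simp
  qed
  ultimately have "maximal_antichain C"
    by (intro maximal_antichainI) (auto simp: top_unique)
  moreover have "\<exists>a\<in>A. c \<le> a" "\<exists>b\<in>B. c \<le> b" if "c \<in> C" for c
    using that unfolding C_def by (blast intro: inf_le1 inf_le2)+
  ultimately show ?thesis
    using A B unfolding refines_def by metis
qed

section \<open>Boolean values of relations between spanning functions\<close>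

text \<open>
  The Boolean value of \<open>R f g\<close>, computed from the two antichains without choosing a common refinement.
\<close>

definition func_val ::
    "('v \<Rightarrow> 'v \<Rightarrow> bool) \<Rightarrow> ('b::{boolean_algebra, complete_lattice} \<rightharpoonup> 'v) \<Rightarrow> ('b \<rightharpoonup> 'v) \<Rightarrow> 'b" where
  "func_val R f g = Sup {inf a b | a b x y. f a = Some x \<and> g b = Some y \<and> R x y}"

text \<open>
  Each \<open>c\<close> in the refinement lies below one piece \<open>inf a b\<close>, on which the two reductions take the values
  \<open>f a\<close> and \<open>g b\<close>. Conversely every \<open>inf a b\<close> is covered by the \<open>c\<close> that meet it, and these lie below it.
\<close>

lemma Sup_refinement_eq_func_val:
  assumes Cf: "refines C (dom f)" and Cg: "refines C (dom g)"
  shows "Sup {c \<in> C. R (the (reduction f C c)) (the (reduction g C c))} = func_val R f g"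
    (is "Sup ?S = _")
proof (rule order.antisym)
  show "Sup ?S \<le> func_val R f g"
  proof (rule Sup_least)
    fix c assume c: "c \<in> ?S"
    obtain a b where ab: "a \<in> dom f" "c \<le> a" "b \<in> dom g" "c \<le> b"
      using c Cf Cg by (auto simp: refines_def) (metis domI)
    obtain x y where "f a = Some x" "g b = Some y" using ab by blast
    moreover have "R x y"
      using c ab calculation reduction_eq[OF Cf, of c a] reduction_eq[OF Cg, of c b] by auto
    ultimately have "inf a b \<le> func_val R f g"
      unfolding func_val_def by (intro Sup_upper) auto
    then show "c \<le> func_val R f g"
      using ab by (meson le_inf_iff order_trans)
  qed
next
  show "func_val R f g \<le> Sup ?S"
    unfolding func_val_def
  proof (rule Sup_least, clarify)
    fix a b x y assume fg: "f a = Some x" "g b = Some y" "R x y"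
    show "inf a b \<le> Sup ?S"
    proof (rule maximal_antichain_cases_le)
      show "maximal_antichain C" using Cf by (simp add: refines_def)
      fix c assume c: "c \<in> C"
      show "inf c (inf a b) \<le> Sup ?S"
      proof (cases "inf c (inf a b) = bot")
        case False
        then have "inf c a \<noteq> bot" "inf c b \<noteq> bot"
          by (auto simp: inf_assoc[symmetric]) (metis inf_assoc inf_bot_right inf_commute)
        then have "c \<le> a" "c \<le> b"
          using refines_part_le[OF Cf c, of a] refines_part_le[OF Cg c, of b] fg by auto
        then have "reduction f C c = Some x" "reduction g C c = Some y"
          using reduction_eq[OF Cf c, of a] reduction_eq[OF Cg c, of b] fg by auto
        then have "c \<le> Sup ?S"
          using c fg by (intro Sup_upper) auto
        then show ?thesis by (meson inf.coboundedI1)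
      qed simp
    qed
  qed
qed

lemma func_eq_iff_func_val:
  assumes "spanning f" "spanning g"
  shows "func_eq U f g \<longleftrightarrow> func_val (=) f g \<in> U"
proof
  assume "func_eq U f g"
  then obtain C where C: "refines C (dom f)" "refines C (dom g)"
    "Sup {c \<in> C. the (reduction f C c) = the (reduction g C c)} \<in> U"
    unfolding func_eq_def by blast
  from C(3) show "func_val (=) f g \<in> U"
    unfolding Sup_refinement_eq_func_val[OF C(1,2), where R = "(=)"] .
next
  assume val: "func_val (=) f g \<in> U"
  obtain C where C: "refines C (dom f)" "refines C (dom g)"
    using common_refinement assms unfolding spanning_def by blast
  from val have "Sup {c \<in> C. the (reduction f C c) = the (reduction g C c)} \<in> U"
    unfolding Sup_refinement_eq_func_val[OF C, where R = "(=)"] .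
  with C show "func_eq U f g" unfolding func_eq_def by blast
qed

lemma func_mem_iff_func_val:
  assumes "spanning f" "spanning g"
  shows "func_mem U f g \<longleftrightarrow> func_val (\<lambda>x y. x \<in> elts y) f g \<in> U"
proof
  assume "func_mem U f g"
  then obtain C where C: "refines C (dom f)" "refines C (dom g)"
    "Sup {c \<in> C. the (reduction f C c) \<in> elts (the (reduction g C c))} \<in> U"
    unfolding func_mem_def by blast
  from C(3) show "func_val (\<lambda>x y. x \<in> elts y) f g \<in> U"
    unfolding Sup_refinement_eq_func_val[OF C(1,2), where R = "\<lambda>x y. x \<in> elts y"] .
next
  assume val: "func_val (\<lambda>x y. x \<in> elts y) f g \<in> U"
  obtain C where C: "refines C (dom f)" "refines C (dom g)"
    using common_refinement assms unfolding spanning_def by blast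
  from val have "Sup {c \<in> C. the (reduction f C c) \<in> elts (the (reduction g C c))} \<in> U"
    unfolding Sup_refinement_eq_func_val[OF C, where R = "\<lambda>x y. x \<in> elts y"] .
  with C show "func_mem U f g" unfolding func_mem_def by blast
qed

text \<open>
  A partition of \<open>top\<close> indexed by sets is turned into a function on its nonzero members; disjointness
  makes the index of a nonzero member unique.
\<close>

lemma spanning_of_partition:
  fixes q :: "'v::zfc_universe \<Rightarrow> 'b::{boolean_algebra, complete_lattice}"
  assumes disj: "\<And>x y. x \<noteq> y \<Longrightarrow> inf (q x) (q y) = bot" and total: "(SUP x. q x) = top"
  shows "\<exists>f. spanning f \<and> (\<forall>x. q x \<noteq> bot \<longrightarrow> f (q x) = Some x)"
proof -
  define f where "f = (\<lambda>b. if b \<noteq> bot \<and> b \<in> range q then Some (inv q b) else None)"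
  have inj: "x = y" if "q x = q y" "q x \<noteq> bot" for x y
    using disj[of x y] that by (metis inf.idem)
  have "f (q x) = Some x" if "q x \<noteq> bot" for x
    using inj[of "inv q (q x)" x] that by (simp add: f_def f_inv_into_f)
  moreover have "dom f = range q - {bot}"
    by (auto simp: f_def dom_def)
  moreover have "maximal_antichain (range q - {bot})"
  proof (rule maximal_antichainI)
    show "antichain (range q - {bot})"
      using disj by (auto simp: antichain_def) metis
    have "top \<le> Sup (range q - {bot})"
      unfolding total[symmetric]
    proof (rule SUP_least)
      fix x
      show "q x \<le> Sup (range q - {bot})"
        by (cases "q x = bot") (auto intro: Sup_upper)
    qed
    then show "Sup (range q - {bot}) = top" by (simp add: top_unique)
  qed
  ultimately show ?thesis unfolding spanning_def by metis
qed

section \<open>The equality axioms for Boolean values of names\<close>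

text \<open>
  Inclusion compares Boolean values of membership on both sides, rather than the Boolean coefficients of
  the entries, so reflexivity needs no induction.
\<close>

lemma val_eq_refl: "val_eq enc \<tau> \<tau> = top"
  by (simp add: val_eq.simps val_sub.simps sup_commute)

lemma val_eq_sym: "val_eq enc \<tau> \<sigma> = val_eq enc \<sigma> \<tau>"
  by (simp add: val_eq.simps inf_commute)

lemma le_val_mem:
  assumes "(\<eta>, b) \<in> name_entries enc \<sigma>"
  shows "inf (val_eq enc \<tau> \<eta>) b \<le> val_mem enc \<tau> \<sigma>"
  unfolding val_mem.simps by (rule SUP_upper2[OF assms]) simp

lemma entry_le_val_mem:
  assumes "(\<eta>, b) \<in> name_entries enc \<sigma>"
  shows "b \<le> val_mem enc \<eta> \<sigma>"
  using le_val_mem[OF assms, of \<eta>] by (simp add: val_eq_refl)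

lemma inf_val_mem_le:
  assumes "\<And>\<eta> b. (\<eta>, b) \<in> name_entries enc \<sigma> \<Longrightarrow> inf (inf (val_eq enc \<tau> \<eta>) b) p \<le> q"
  shows "inf (val_mem enc \<tau> \<sigma>) p \<le> q"
  unfolding val_mem.simps by (rule inf_SUP_le) (use assms in auto)

lemma val_subD:
  assumes "\<eta> \<in> name_dom enc \<tau>"
  shows "inf (val_mem enc \<eta> \<tau>) (val_sub enc \<tau> \<sigma>) \<le> val_mem enc \<eta> \<sigma>"
proof -
  have "val_sub enc \<tau> \<sigma> \<le> sup (- val_mem enc \<eta> \<tau>) (val_mem enc \<eta> \<sigma>)"
    unfolding val_sub.simps[of _ \<tau>] by (rule INF_lower[OF assms])
  then show ?thesis by (simp add: shunt1[symmetric] inf_commute)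
qed

lemma le_val_sub:
  assumes "\<And>\<eta>. \<eta> \<in> name_dom enc \<tau> \<Longrightarrow> inf p (val_mem enc \<eta> \<tau>) \<le> val_mem enc \<eta> \<sigma>"
  shows "p \<le> val_sub enc \<tau> \<sigma>"
  unfolding val_sub.simps[of _ \<tau>] by (rule INF_greatest) (use assms in \<open>simp add: shunt1\<close>)

text \<open>
  The inductive step for transitivity. Being a member of \<open>\<sigma>\<close> means being equal to some \<open>\<zeta>\<close> in its domain,
  which is then equal to some \<open>\<xi>\<close> in the domain of \<open>\<rho>\<close>. Transitivity is therefore needed only for
  triples \<open>\<eta>, \<zeta>, \<xi>\<close>; its form as a premise lets the induction use it with either \<open>\<eta>\<close> or \<open>\<xi>\<close> as the
  smaller name.
\<close>

lemma val_mem_val_sub_of_trans: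
  assumes trans: "\<And>\<zeta> \<xi>. \<xi> \<in> name_dom enc \<rho> \<Longrightarrow>
      inf (val_eq enc \<eta> \<zeta>) (val_eq enc \<zeta> \<xi>) \<le> val_eq enc \<eta> \<xi>"
  shows "inf (val_mem enc \<eta> \<sigma>) (val_sub enc \<sigma> \<rho>) \<le> val_mem enc \<eta> \<rho>"
proof (rule inf_val_mem_le)
  fix \<zeta> b assume \<zeta>: "(\<zeta>, b) \<in> name_entries enc \<sigma>"
  have *: "inf (val_mem enc \<zeta> \<rho>) (val_eq enc \<eta> \<zeta>) \<le> val_mem enc \<eta> \<rho>"
  proof (rule inf_val_mem_le)
    fix \<xi> c assume \<xi>: "(\<xi>, c) \<in> name_entries enc \<rho>"
    then have "inf (val_eq enc \<eta> \<zeta>) (val_eq enc \<zeta> \<xi>) \<le> val_eq enc \<eta> \<xi>"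
      by (intro trans) (force simp: name_dom_def)
    then have "inf (inf (val_eq enc \<eta> \<zeta>) (val_eq enc \<zeta> \<xi>)) c \<le> inf (val_eq enc \<eta> \<xi>) c"
      by (rule inf_mono) simp
    also have "\<dots> \<le> val_mem enc \<eta> \<rho>" by (rule le_val_mem[OF \<xi>])
    finally show "inf (inf (val_eq enc \<zeta> \<xi>) c) (val_eq enc \<eta> \<zeta>) \<le> val_mem enc \<eta> \<rho>"
      by (simp add: ac_simps)
  qed
  have "inf b (val_sub enc \<sigma> \<rho>) \<le> inf (val_mem enc \<zeta> \<sigma>) (val_sub enc \<sigma> \<rho>)"
    by (rule inf_mono) (simp_all add: entry_le_val_mem[OF \<zeta>])
  also have "\<dots> \<le> val_mem enc \<zeta> \<rho>"
    by (rule val_subD) (use \<zeta> in \<open>force simp: name_dom_def\<close>)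
  finally have "inf (inf b (val_sub enc \<sigma> \<rho>)) (val_eq enc \<eta> \<zeta>) \<le> inf (val_mem enc \<zeta> \<rho>) (val_eq enc \<eta> \<zeta>)"
    by (rule inf_mono) simp
  also note *
  finally show "inf (inf (val_eq enc \<eta> \<zeta>) b) (val_sub enc \<sigma> \<rho>) \<le> val_mem enc \<eta> \<rho>"
    by (simp add: ac_simps)
qed

text \<open>
  Induction on the first name is enough. One inclusion uses the induction hypothesis as it stands; the
  other runs from \<open>\<rho>\<close> to \<open>\<tau>\<close> and uses it read backwards, which symmetry of equality permits.
\<close>

lemma val_eq_trans: "inf (val_eq enc \<tau> \<sigma>) (val_eq enc \<sigma> \<rho>) \<le> val_eq enc \<tau> \<rho>"
proof (induction \<tau> arbitrary: \<sigma> \<rho> rule: wf_induct_rule[OF wf_trancl[OF wf_vmem]])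
  case (1 \<tau>)
  have IH: "inf (val_eq enc \<eta> \<zeta>) (val_eq enc \<zeta> \<xi>) \<le> val_eq enc \<eta> \<xi>"
    if "\<eta> \<in> name_dom enc \<tau>" for \<eta> \<zeta> \<xi>
    using that 1 by (auto simp: name_dom_def name_entries_def dest: vpair_fst_trancl)
  have forward: "inf (val_sub enc \<tau> \<sigma>) (val_sub enc \<sigma> \<rho>) \<le> val_sub enc \<tau> \<rho>"
  proof (rule le_val_sub)
    fix \<eta> assume \<eta>: "\<eta> \<in> name_dom enc \<tau>"
    have "inf (inf (val_mem enc \<eta> \<tau>) (val_sub enc \<tau> \<sigma>)) (val_sub enc \<sigma> \<rho>)
        \<le> inf (val_mem enc \<eta> \<sigma>) (val_sub enc \<sigma> \<rho>)"
      by (rule inf_mono[OF val_subD[OF \<eta>]]) simp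
    also have "\<dots> \<le> val_mem enc \<eta> \<rho>"
      by (rule val_mem_val_sub_of_trans) (rule IH[OF \<eta>])
    finally show "inf (inf (val_sub enc \<tau> \<sigma>) (val_sub enc \<sigma> \<rho>)) (val_mem enc \<eta> \<tau>) \<le> val_mem enc \<eta> \<rho>"
      by (simp add: ac_simps)
  qed
  have backward: "inf (val_sub enc \<rho> \<sigma>) (val_sub enc \<sigma> \<tau>) \<le> val_sub enc \<rho> \<tau>"
  proof (rule le_val_sub)
    fix \<eta> assume \<eta>: "\<eta> \<in> name_dom enc \<rho>"
    have "inf (inf (val_mem enc \<eta> \<rho>) (val_sub enc \<rho> \<sigma>)) (val_sub enc \<sigma> \<tau>)
        \<le> inf (val_mem enc \<eta> \<sigma>) (val_sub enc \<sigma> \<tau>)"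
      by (rule inf_mono[OF val_subD[OF \<eta>]]) simp
    also have "\<dots> \<le> val_mem enc \<eta> \<tau>"
    proof (rule val_mem_val_sub_of_trans)
      fix \<zeta> \<xi> assume "\<xi> \<in> name_dom enc \<tau>"
      from IH[OF this, of \<zeta> \<eta>]
      show "inf (val_eq enc \<eta> \<zeta>) (val_eq enc \<zeta> \<xi>) \<le> val_eq enc \<eta> \<xi>"
        by (simp add: val_eq_sym[of enc \<xi>] val_eq_sym[of enc \<zeta> \<eta>] inf_commute)
    qed
    finally show "inf (inf (val_sub enc \<rho> \<sigma>) (val_sub enc \<sigma> \<tau>)) (val_mem enc \<eta> \<rho>) \<le> val_mem enc \<eta> \<tau>"
      by (simp add: ac_simps)
  qed
  have "inf (val_eq enc \<tau> \<sigma>) (val_eq enc \<sigma> \<rho>)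
      = inf (inf (val_sub enc \<tau> \<sigma>) (val_sub enc \<sigma> \<rho>)) (inf (val_sub enc \<rho> \<sigma>) (val_sub enc \<sigma> \<tau>))"
    by (simp add: val_eq.simps ac_simps)
  also have "\<dots> \<le> val_eq enc \<tau> \<rho>"
    unfolding val_eq.simps[of _ \<tau> \<rho>] by (rule inf_mono[OF forward backward])
  finally show ?case .
qed

lemma val_eq_cong:
  "inf (val_eq enc \<sigma> \<tau>) (inf (val_eq enc \<sigma> \<sigma>') (val_eq enc \<tau> \<tau>')) \<le> val_eq enc \<sigma>' \<tau>'"
proof -
  have "inf (inf (val_eq enc \<sigma>' \<sigma>) (val_eq enc \<sigma> \<tau>)) (val_eq enc \<tau> \<tau>')
      \<le> inf (val_eq enc \<sigma>' \<tau>) (val_eq enc \<tau> \<tau>')"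
    by (rule inf_mono[OF val_eq_trans]) simp
  also have "\<dots> \<le> val_eq enc \<sigma>' \<tau>'" by (rule val_eq_trans)
  finally show ?thesis by (simp add: val_eq_sym[of enc \<sigma>'] ac_simps)
qed

lemma val_mem_cong:
  "inf (val_mem enc \<sigma> \<tau>) (inf (val_eq enc \<sigma> \<sigma>') (val_eq enc \<tau> \<tau>')) \<le> val_mem enc \<sigma>' \<tau>'"
proof -
  have *: "inf (val_mem enc \<sigma> \<tau>) (val_eq enc \<sigma> \<sigma>') \<le> val_mem enc \<sigma>' \<tau>"
  proof (rule inf_val_mem_le)
    fix \<eta> b assume \<eta>: "(\<eta>, b) \<in> name_entries enc \<tau>"
    have "inf (inf (val_eq enc \<sigma>' \<sigma>) (val_eq enc \<sigma> \<eta>)) b \<le> inf (val_eq enc \<sigma>' \<eta>) b"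
      by (rule inf_mono[OF val_eq_trans]) simp
    also have "\<dots> \<le> val_mem enc \<sigma>' \<tau>" by (rule le_val_mem[OF \<eta>])
    finally show "inf (inf (val_eq enc \<sigma> \<eta>) b) (val_eq enc \<sigma> \<sigma>') \<le> val_mem enc \<sigma>' \<tau>"
      by (simp add: val_eq_sym[of enc \<sigma>'] ac_simps)
  qed
  have "inf (inf (val_mem enc \<sigma> \<tau>) (val_eq enc \<sigma> \<sigma>')) (val_eq enc \<tau> \<tau>')
      \<le> inf (val_mem enc \<sigma>' \<tau>) (val_sub enc \<tau> \<tau>')"
    by (rule inf_mono[OF *]) (simp add: val_eq.simps)
  also have "\<dots> \<le> val_mem enc \<sigma>' \<tau>'"
    by (rule val_mem_val_sub_of_trans) (rule val_eq_trans)
  finally show ?thesis by (simp add: ac_simps)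
qed

section \<open>Check names and mixtures\<close>

lemma name_entries_check:
  assumes "coded enc"
  shows "name_entries enc (check enc x) = (\<lambda>y. (check enc y, top)) ` elts x"
  using assms by (auto simp: name_entries_def elts_check coded_def inj_eq)

lemma val_mem_check_right:
  assumes "coded enc"
  shows "val_mem enc \<tau> (check enc x) = (SUP y\<in>elts x. val_eq enc \<tau> (check enc y))"
  by (simp add: val_mem.simps name_entries_check[OF assms] image_image)

lemma val_mem_check_of_mem:
  assumes "coded enc" "y \<in> elts x"
  shows "val_mem enc (check enc y) (check enc x) = top"
  using entry_le_val_mem[of "check enc y" top enc "check enc x"] assms
  by (simp add: name_entries_check top_unique)

text \<open>
  A set \<open>z\<close> in exactly one of \<open>x\<close> and \<open>y\<close> refutes one inclusion: its check name belongs to one side with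
  value \<open>top\<close>, and by induction it differs with value \<open>top\<close> from every member of the other side.
\<close>

lemma val_eq_check_distinct:
  assumes "coded enc" "x \<noteq> y"
  shows "val_eq enc (check enc x) (check enc y) = bot"
  using assms(2)
proof (induction x arbitrary: y rule: wf_induct_rule[OF wf_vmem])
  case (1 x)
  have sub_bot: "val_sub enc (check enc u) (check enc v) = bot"
    if "z \<in> elts u" "val_mem enc (check enc z) (check enc v) = bot" for u v z
  proof -
    have "check enc z \<in> name_dom enc (check enc u)"
      using that(1) by (force simp: name_dom_def name_entries_check[OF assms(1)])
    from val_subD[OF this, of "check enc v"] show ?thesis
      using that val_mem_check_of_mem[OF assms(1) that(1)] by (simp add: bot_unique)
  qed
  from 1(2) extensionality obtain z where "z \<in> elts x \<and> z \<notin> elts y \<or> z \<in> elts y \<and> z \<notin> elts x"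
    by blast
  then show ?case
  proof
    assume z: "z \<in> elts x \<and> z \<notin> elts y"
    then have "val_eq enc (check enc z) (check enc w) = bot" if "w \<in> elts y" for w
      using 1(1)[of z w] that by (auto simp: vmem_def)
    then have "val_sub enc (check enc x) (check enc y) = bot"
      using z by (intro sub_bot[of z]) (auto simp: val_mem_check_right[OF assms(1)])
    then show ?thesis by (simp add: val_eq.simps)
  next
    assume z: "z \<in> elts y \<and> z \<notin> elts x"
    then have "val_eq enc (check enc z) (check enc w) = bot" if "w \<in> elts x" for w
      using 1(1)[of w z] that by (auto simp: vmem_def val_eq_sym[of enc "check enc z"])
    then have "val_sub enc (check enc y) (check enc x) = bot"
      using z by (intro sub_bot[of z]) (auto simp: val_mem_check_right[OF assms(1)])
    then show ?thesis by (simp add: val_eq.simps)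
  qed
qed

lemma val_eq_check:
  assumes "coded enc"
  shows "val_eq enc (check enc x) (check enc y) = (if x = y then top else bot)"
  using val_eq_check_distinct[OF assms] by (simp add: val_eq_refl)

lemma val_mem_check:
  assumes "coded enc"
  shows "val_mem enc (check enc x) (check enc y) = (if x \<in> elts y then top else bot)"
  using val_mem_check_of_mem[OF assms]
  by (auto simp: val_mem_check_right[OF assms] val_eq_check[OF assms])

text \<open>
  The gluing of the check names of the values of \<open>f\<close> along the antichain \<open>dom f\<close>.
\<close>

definition mixture ::
    "('b::{boolean_algebra, complete_lattice} \<Rightarrow> 'v::zfc_universe) \<Rightarrow> ('b \<rightharpoonup> 'v) \<Rightarrow> 'v" where
  "mixture enc f = vset {vpair (check enc y) (enc a) | y a x. f a = Some x \<and> y \<in> elts x}"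

text \<open>
  Replacement, iterated over the codes of \<open>dom f\<close> and then over each value of \<open>f\<close>, shows that the entries
  form a set.
\<close>

lemma elts_mixture:
  assumes "coded enc"
  shows "elts (mixture enc f) = {vpair (check enc y) (enc a) | y a x. f a = Some x \<and> y \<in> elts x}"
proof -
  have inv: "inv enc (enc a) = a" for a
    using assms by (simp add: coded_def)
  have "small (enc ` dom f)"
    using assms by (auto simp: coded_def intro: small_subset)
  then obtain D where D: "elts D = enc ` dom f" by (auto simp: small_def)
  define F where "F = (\<lambda>e. vset ((\<lambda>y. vpair (check enc y) e) ` elts (the (f (inv enc e)))))"
  have "small (\<Union>e\<in>elts D. elts (F e))" by (rule small_UN)
  also have "(\<Union>e\<in>elts D. elts (F e))
      = {vpair (check enc y) (enc a) | y a x. f a = Some x \<and> y \<in> elts x}"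
    unfolding D F_def
    by (subst elts_vset) (auto simp: small_image inv, force simp: inv)
  finally show ?thesis by (simp add: mixture_def elts_vset)
qed

lemma name_entries_mixture:
  assumes "coded enc"
  shows "name_entries enc (mixture enc f) = {(check enc y, a) | y a x. f a = Some x \<and> y \<in> elts x}"
  using assms by (auto simp: name_entries_def elts_mixture coded_def inj_eq)

lemma is_name_check: "is_name enc (check enc x)"
proof (induction x rule: wf_induct_rule[OF wf_vmem])
  case (1 x)
  then show ?case
    by (intro is_name.intros) (auto simp: elts_check vmem_def)
qed

lemma is_name_mixture:
  assumes "coded enc"
  shows "is_name enc (mixture enc f)"
  by (intro is_name.intros) (auto simp: elts_mixture[OF assms] is_name_check)

text \<open>
  An entry with coefficient \<open>b\<close> contributes below \<open>a\<close> only if \<open>b = a\<close>, as the coefficients come from an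
  antichain, and the entries with coefficient \<open>a\<close> are the check names of the members of \<open>f a\<close>.
\<close>

lemma le_val_eq_mixture_check:
  assumes enc: "coded enc" and f: "spanning f" and fa: "f a = Some x"
  shows "a \<le> val_eq enc (mixture enc f) (check enc x)"
  unfolding val_eq.simps
proof (rule le_infI)
  show "a \<le> val_sub enc (mixture enc f) (check enc x)"
  proof (rule le_val_sub)
    fix \<eta>
    have "inf (val_mem enc \<eta> (mixture enc f)) a \<le> val_mem enc \<eta> (check enc x)"
    proof (rule inf_val_mem_le)
      fix \<zeta> b assume "(\<zeta>, b) \<in> name_entries enc (mixture enc f)"
      then obtain y z where b: "\<zeta> = check enc y" "f b = Some z" "y \<in> elts z"
        by (auto simp: name_entries_mixture[OF enc])
      show "inf (inf (val_eq enc \<eta> \<zeta>) b) a \<le> val_mem enc \<eta> (check enc x)"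
      proof (cases "b = a")
        case True
        then have "val_eq enc \<eta> \<zeta> \<le> val_mem enc \<eta> (check enc x)"
          using le_val_mem[of \<zeta> top enc "check enc x" \<eta>] b fa
          by (auto simp: name_entries_check[OF enc])
        then show ?thesis by (meson inf.coboundedI1)
      next
        case False
        then have "inf b a = bot"
          using f b fa by (auto simp: spanning_def maximal_antichain_def antichain_def dom_def)
        then show ?thesis by (simp add: inf_assoc)
      qed
    qed
    then show "inf a (val_mem enc \<eta> (mixture enc f)) \<le> val_mem enc \<eta> (check enc x)"
      by (simp add: inf_commute)
  qed
  show "a \<le> val_sub enc (check enc x) (mixture enc f)"
  proof (rule le_val_sub)
    fix \<eta> assume "\<eta> \<in> name_dom enc (check enc x)"
    then obtain y where "\<eta> = check enc y" "y \<in> elts x"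
      by (auto simp: name_dom_def name_entries_check[OF enc])
    then have "a \<le> val_mem enc \<eta> (mixture enc f)"
      using fa by (intro entry_le_val_mem) (auto simp: name_entries_mixture[OF enc])
    then show "inf a (val_mem enc \<eta> (check enc x)) \<le> val_mem enc \<eta> (mixture enc f)"
      by (meson inf.coboundedI1)
  qed
qed

text \<open>
  Stated for any Boolean-valued relation \<open>F\<close> that respects equality and decides check names, so that
  equality and membership are treated at once. On the piece \<open>inf a b\<close> the mixtures may be replaced by the
  check names of \<open>f a\<close> and \<open>g b\<close>, where \<open>F\<close> is \<open>top\<close> or \<open>bot\<close>.
\<close>

lemma val_mixture_eq_func_val:
  fixes F :: "'v::zfc_universe \<Rightarrow> 'v \<Rightarrow> 'b::{boolean_algebra, complete_lattice}"
  assumes enc: "coded enc" and f: "spanning f" and g: "spanning g"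
    and cong: "\<And>\<sigma> \<sigma>' \<tau> \<tau>'. inf (F \<sigma> \<tau>) (inf (val_eq enc \<sigma> \<sigma>') (val_eq enc \<tau> \<tau>')) \<le> F \<sigma>' \<tau>'"
    and abs: "\<And>x y. F (check enc x) (check enc y) = (if R x y then top else bot)"
  shows "F (mixture enc f) (mixture enc g) = func_val R f g"
proof (rule order.antisym)
  show "F (mixture enc f) (mixture enc g) \<le> func_val R f g"
  proof (rule maximal_antichain_cases_le, rule f[unfolded spanning_def],
      rule maximal_antichain_cases_le, rule g[unfolded spanning_def])
    fix a b assume "a \<in> dom f" "b \<in> dom g"
    then obtain x y where xy: "f a = Some x" "g b = Some y" by auto
    show "inf b (inf a (F (mixture enc f) (mixture enc g))) \<le> func_val R f g"
    proof (cases "R x y")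
      case True
      with xy have "inf a b \<le> func_val R f g"
        unfolding func_val_def by (intro Sup_upper) auto
      then show ?thesis by (metis inf.coboundedI1 inf_assoc inf_commute)
    next
      case False
      have "inf (F (mixture enc f) (mixture enc g)) (inf a b)
          \<le> inf (F (mixture enc f) (mixture enc g))
               (inf (val_eq enc (mixture enc f) (check enc x)) (val_eq enc (mixture enc g) (check enc y)))"
        using xy by (intro inf_mono order_refl le_val_eq_mixture_check enc f g)
      also have "\<dots> \<le> F (check enc x) (check enc y)" by (rule cong)
      also have "\<dots> = bot" using abs False by simp
      finally show ?thesis by (simp add: ac_simps bot_unique)
    qed
  qed
next
  show "func_val R f g \<le> F (mixture enc f) (mixture enc g)"
    unfolding func_val_def
  proof (rule Sup_least, clarify)
    fix a b x y assume xy: "f a = Some x" "g b = Some y" "R x y"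
    then have "inf a b \<le> inf (F (check enc x) (check enc y))
        (inf (val_eq enc (check enc x) (mixture enc f)) (val_eq enc (check enc y) (mixture enc g)))"
      using inf_mono[OF le_val_eq_mixture_check[OF enc f xy(1)] le_val_eq_mixture_check[OF enc g xy(2)]]
      by (simp add: abs val_eq_sym[of enc "check enc _"])
    also have "\<dots> \<le> F (mixture enc f) (mixture enc g)" by (rule cong)
    finally show "inf a b \<le> F (mixture enc f) (mixture enc g)" .
  qed
qed

lemma func_eq_iff_name_eq_mixture:
  assumes "coded enc" "spanning f" "spanning g"
  shows "func_eq U f g \<longleftrightarrow> name_eq enc U (mixture enc f) (mixture enc g)"
  unfolding func_eq_iff_func_val[OF assms(2,3)] name_eq_def
  by (subst val_mixture_eq_func_val[where F = "val_eq enc" and R = "(=)",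
        OF assms val_eq_cong val_eq_check[OF assms(1)]]) (rule refl)

lemma func_mem_iff_name_mem_mixture:
  assumes "coded enc" "spanning f" "spanning g"
  shows "func_mem U f g \<longleftrightarrow> name_mem enc U (mixture enc f) (mixture enc g)"
  unfolding func_mem_iff_func_val[OF assms(2,3)] name_mem_def
  by (subst val_mixture_eq_func_val[where F = "val_mem enc" and R = "\<lambda>x y. x \<in> elts y",
        OF assms val_mem_cong val_mem_check[OF assms(1)]]) (rule refl)

lemma val_in_ground_mixture:
  assumes "coded enc" "spanning f"
  shows "val_in_ground enc (mixture enc f) = top"
proof -
  have "top \<le> val_in_ground enc (mixture enc f)"
  proof (rule maximal_antichain_cases_le, rule assms(2)[unfolded spanning_def])
    fix a assume "a \<in> dom f"
    then obtain x where "f a = Some x" by auto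
    then have "a \<le> val_in_ground enc (mixture enc f)"
      unfolding val_in_ground_def by (intro SUP_upper2[of x] le_val_eq_mixture_check assms) auto
    then show "inf a top \<le> val_in_ground enc (mixture enc f)" by simp
  qed
  then show ?thesis by (simp add: top_unique)
qed

text \<open>
  The pieces \<open>val_eq \<tau> (check x)\<close> are pairwise disjoint, as distinct check names are equal with value
  \<open>bot\<close>. So they can carry a spanning function with value \<open>x\<close> on the piece of \<open>x\<close>, and on each piece
  its mixture and \<open>\<tau>\<close> are both equal to the same check name.
\<close>

lemma val_in_ground_le_val_eq_mixture:
  assumes enc: "coded enc"
  shows "\<exists>f. spanning f \<and> val_in_ground enc \<tau> \<le> val_eq enc (mixture enc f) \<tau>"
proof -
  define q where "q = (\<lambda>x. val_eq enc \<tau> (check enc x))"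
  define d where "d = val_in_ground enc \<tau>"
  \<comment> \<open>The values \<open>q x\<close> add up to \<open>d\<close> only. The missing part \<open>- d\<close> is given to the empty set, an arbitrary
    choice, which turns them into a partition of \<open>top\<close>.\<close>
  define q' where "q' = (\<lambda>x. if x = vset {} then sup (q x) (- d) else q x)"
  have q_disj: "inf (q x) (q y) = bot" if "x \<noteq> y" for x y
    using val_eq_trans[of enc "check enc x" \<tau> "check enc y"] that
    by (simp add: q_def val_eq_check[OF enc] val_eq_sym[of enc "check enc x"] bot_unique)
  have q_d: "inf (q x) (- d) = bot" for x
  proof -
    have "q x \<le> d" unfolding q_def d_def val_in_ground_def by (rule SUP_upper) simp
    then show ?thesis by (simp add: inf_shunt)
  qed
  have "inf (q' x) (q' y) = bot" if "x \<noteq> y" for x y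
    using that q_disj[OF that] q_d[of x] q_d[of y]
    by (auto simp: q'_def inf_sup_distrib1 inf_sup_distrib2 inf_commute)
  moreover have "(SUP x. q' x) = top"
  proof -
    have "d \<le> (SUP x. q' x)"
      unfolding d_def val_in_ground_def
      by (rule SUP_mono') (auto simp: q'_def q_def)
    moreover have "- d \<le> (SUP x. q' x)"
      by (rule SUP_upper2[of "vset {}"]) (simp_all add: q'_def)
    ultimately show ?thesis by (metis le_sup_iff sup_compl_top top_unique)
  qed
  ultimately obtain f where f: "spanning f" "\<And>x. q' x \<noteq> bot \<Longrightarrow> f (q' x) = Some x"
    using spanning_of_partition[of q'] by blast
  have "d \<le> val_eq enc (mixture enc f) \<tau>"
    unfolding d_def val_in_ground_def
  proof (rule SUP_least)
    fix x
    have "q x \<le> q' x" by (simp add: q'_def)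
    also have "q' x \<le> val_eq enc (mixture enc f) (check enc x)"
      by (cases "q' x = bot") (simp_all add: le_val_eq_mixture_check[OF enc f(1)] f(2))
    finally have "q x \<le> inf (val_eq enc (mixture enc f) (check enc x)) (val_eq enc (check enc x) \<tau>)"
      by (simp add: q_def val_eq_sym[of enc "check enc x"])
    also have "\<dots> \<le> val_eq enc (mixture enc f) \<tau>" by (rule val_eq_trans)
    finally show "val_eq enc \<tau> (check enc x) \<le> val_eq enc (mixture enc f) \<tau>" by (simp add: q_def)
  qed
  then show ?thesis using f(1) by (auto simp: d_def)
qed

section \<open>Ranks and minimal representatives\<close>

lemma rank_trans:
  assumes "z \<in> elts (rank x)"
  shows "elts z \<subseteq> elts (rank x)"
  using assms
proof (induction x rule: wf_induct_rule[OF wf_vmem])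
  case (1 x)
  then show ?case by (auto simp: elts_rank[of x] vmem_def)
qed

text \<open>
  Trichotomy of ordinals, proved for ranks by a double induction: if neither rank is a member of the
  other, the induction hypotheses put every member of each into the other, so they are equal.
\<close>

lemma rank_linear: "rank x \<in> elts (rank y) \<or> rank x = rank y \<or> rank y \<in> elts (rank x)"
proof (induction x arbitrary: y rule: wf_induct_rule[OF wf_vmem])
  case (1 x)
  note IHx = 1
  show ?case
  proof (induction y rule: wf_induct_rule[OF wf_vmem])
    case (1 y)
    show ?case
    proof (rule ccontr)
      assume neg: "\<not> ?case"
      have "rank x' \<in> elts (rank y)" if "x' \<in> elts x" for x'
        using IHx[of x' y] neg that elts_rank[of x] by (auto simp: vmem_def)
      then have "elts (rank x) \<subseteq> elts (rank y)"
        using rank_trans by (fastforce simp: elts_rank[of x])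
      moreover have "rank y' \<in> elts (rank x)" if "y' \<in> elts y" for y'
        using 1[of y'] neg that elts_rank[of y] by (auto simp: vmem_def)
      then have "elts (rank y) \<subseteq> elts (rank x)"
        using rank_trans by (fastforce simp: elts_rank[of y])
      ultimately show False
        using neg extensionality by blast
    qed
  qed
qed

lemma ex_minimal_rank:
  assumes "P \<tau>"
  shows "\<exists>\<sigma>. P \<sigma> \<and> (\<forall>\<sigma>'. P \<sigma>' \<longrightarrow> elts (rank \<sigma>) \<subseteq> elts (rank \<sigma>'))"
proof -
  from assms obtain \<sigma> where \<sigma>: "P \<sigma>" "\<And>\<sigma>'. (rank \<sigma>', rank \<sigma>) \<in> vmem \<Longrightarrow> \<not> P \<sigma>'"
    using wfE_min[OF wf_inv_image[OF wf_vmem, of rank], of \<tau> "Collect P"] by auto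
  have "elts (rank \<sigma>) \<subseteq> elts (rank \<sigma>')" if "P \<sigma>'" for \<sigma>'
    using rank_linear[of \<sigma> \<sigma>'] \<sigma>(2)[of \<sigma>'] that rank_trans by (auto simp: vmem_def)
  with \<sigma>(1) show ?thesis by blast
qed

section \<open>Classes of names modulo an ultrafilter\<close>

lemma ultrafilter_mono: "ultrafilter U \<Longrightarrow> a \<in> U \<Longrightarrow> a \<le> b \<Longrightarrow> b \<in> U"
  by (auto simp: ultrafilter_def)

lemma ultrafilter_inf: "ultrafilter U \<Longrightarrow> a \<in> U \<Longrightarrow> b \<in> U \<Longrightarrow> inf a b \<in> U"
  by (auto simp: ultrafilter_def)

lemma ultrafilter_top: "ultrafilter U \<Longrightarrow> top \<in> U"
  by (auto simp: ultrafilter_def)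

lemma name_eq_refl: "ultrafilter U \<Longrightarrow> name_eq enc U \<tau> \<tau>"
  by (simp add: name_eq_def val_eq_refl ultrafilter_top)

lemma name_eq_sym: "name_eq enc U \<tau> \<sigma> \<longleftrightarrow> name_eq enc U \<sigma> \<tau>"
  by (simp add: name_eq_def val_eq_sym[of enc \<tau>])

lemma name_eq_trans:
  assumes "ultrafilter U" "name_eq enc U \<tau> \<sigma>" "name_eq enc U \<sigma> \<rho>"
  shows "name_eq enc U \<tau> \<rho>"
  using ultrafilter_mono[OF assms(1) ultrafilter_inf[OF assms(1)] val_eq_trans] assms(2,3)
  unfolding name_eq_def by blast

lemma name_mem_cong:
  assumes "ultrafilter U" "name_mem enc U \<sigma> \<tau>" "name_eq enc U \<sigma> \<sigma>'" "name_eq enc U \<tau> \<tau>'"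
  shows "name_mem enc U \<sigma>' \<tau>'"
  using ultrafilter_mono[OF assms(1)
      ultrafilter_inf[OF assms(1) _ ultrafilter_inf[OF assms(1)]] val_mem_cong] assms(2-4)
  unfolding name_eq_def name_mem_def by blast

lemma name_class_nonempty:
  assumes "ultrafilter U" "is_name enc \<tau>"
  shows "name_class enc U \<tau> \<noteq> {}"
  using ex_minimal_rank[of "\<lambda>\<sigma>. is_name enc \<sigma> \<and> name_eq enc U \<sigma> \<tau>" \<tau>] assms
  by (auto simp: name_class_def name_eq_refl)

text \<open>
  A common member of minimal rank witnesses the equality of the two names.
\<close>

lemma name_class_eq_iff:
  assumes U: "ultrafilter U" and \<tau>: "is_name enc \<tau>"
  shows "name_class enc U \<tau> = name_class enc U \<sigma> \<longleftrightarrow> name_eq enc U \<tau> \<sigma>"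
proof
  assume "name_class enc U \<tau> = name_class enc U \<sigma>"
  moreover obtain \<rho> where "\<rho> \<in> name_class enc U \<tau>"
    using name_class_nonempty[OF assms] by blast
  ultimately have "name_eq enc U \<rho> \<tau>" "name_eq enc U \<rho> \<sigma>"
    by (auto simp: name_class_def)
  then show "name_eq enc U \<tau> \<sigma>"
    by (metis name_eq_trans[OF U] name_eq_sym)
next
  assume "name_eq enc U \<tau> \<sigma>"
  then have "name_eq enc U \<rho> \<tau> \<longleftrightarrow> name_eq enc U \<rho> \<sigma>" for \<rho>
    by (metis name_eq_trans[OF U] name_eq_sym)
  then show "name_class enc U \<tau> = name_class enc U \<sigma>"
    by (simp add: name_class_def)
qed

lemma name_ultrapower_mem_iff:
  assumes U: "ultrafilter U" and "is_name enc \<sigma>" "is_name enc \<tau>"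
  shows "snd (name_ultrapower enc U) (name_class enc U \<sigma>) (name_class enc U \<tau>) \<longleftrightarrow> name_mem enc U \<sigma> \<tau>"
proof -
  obtain \<sigma>0 \<tau>0 where 0: "\<sigma>0 \<in> name_class enc U \<sigma>" "\<tau>0 \<in> name_class enc U \<tau>"
    using name_class_nonempty[OF U] assms(2,3) by blast
  have rep: "name_eq enc U \<rho> \<tau>" "name_eq enc U \<tau> \<rho>" if "\<rho> \<in> name_class enc U \<tau>" for \<rho> \<tau>
    using that name_eq_sym by (auto simp: name_class_def)
  show ?thesis
    unfolding name_ultrapower_def snd_conv
  proof
    assume "\<exists>\<sigma>'\<in>name_class enc U \<sigma>. \<exists>\<tau>'\<in>name_class enc U \<tau>. name_mem enc U \<sigma>' \<tau>'"
    then show "name_mem enc U \<sigma> \<tau>"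
      using rep(1) name_mem_cong[OF U] by blast
  next
    assume "name_mem enc U \<sigma> \<tau>"
    then have "name_mem enc U \<sigma>0 \<tau>0"
      by (rule name_mem_cong[OF U]) (rule rep(2)[OF 0(1)], rule rep(2)[OF 0(2)])
    with 0 show "\<exists>\<sigma>'\<in>name_class enc U \<sigma>. \<exists>\<tau>'\<in>name_class enc U \<tau>. name_mem enc U \<sigma>' \<tau>'"
      by blast
  qed
qed

section \<open>The isomorphism\<close>

theorem theorem30:
  fixes enc :: "'b::{boolean_algebra, complete_lattice} \<Rightarrow> 'v::zfc_universe"
    and U :: "'b set"
  assumes "coded enc"
    and "ultrafilter U"
  shows "\<exists>\<pi> :: ('b \<rightharpoonup> 'v) set \<Rightarrow> 'v set.
           isomorphism \<pi> (func_ultrapower U) (name_ultrapower enc U) \<and>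
           (\<forall>x. \<pi> (func_embedding U x) = name_embedding enc U x)"
proof -
  note enc = assms(1) and U = assms(2)
  define c where "c = (\<lambda>f :: 'b \<rightharpoonup> 'v. name_class enc U (mixture enc f))"
  \<comment> \<open>All members of a class of functions give the same \<open>c f\<close>, so the union picks it out without a choice
    of representative.\<close>
  define \<pi> where "\<pi> = (\<lambda>X. \<Union>f\<in>X. c f)"
  have c_eq_iff: "c f = c g \<longleftrightarrow> func_eq U f g" if "spanning f" "spanning g" for f g
    using that by (simp add: c_def name_class_eq_iff[OF U is_name_mixture[OF enc]]
        func_eq_iff_name_eq_mixture[OF enc])
  have mem_class: "g \<in> func_class U f \<longleftrightarrow> spanning g \<and> c g = c f" if "spanning f" for f g
    using c_eq_iff[OF _ that, of g] by (auto simp: func_class_def)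
  have \<pi>_class: "\<pi> (func_class U f) = c f" if "spanning f" for f
    using that mem_class[OF that] unfolding \<pi>_def by blast
  have class_eq: "func_class U f = func_class U g" if "spanning f" "spanning g" "c f = c g" for f g
    using that(3) mem_class[OF that(1)] mem_class[OF that(2)] by (simp add: set_eq_iff)
  have bij: "bij_betw \<pi> (fst (func_ultrapower U)) (fst (name_ultrapower enc U))"
    unfolding bij_betw_def
  proof
    show "inj_on \<pi> (fst (func_ultrapower U))"
      unfolding inj_on_def func_ultrapower_def fst_conv
    proof clarify
      fix f g :: "'b \<rightharpoonup> 'v"
      assume fg: "spanning f" "spanning g" and eq: "\<pi> (func_class U f) = \<pi> (func_class U g)"
      show "func_class U f = func_class U g"
        using eq by (intro class_eq fg) (simp add: \<pi>_class fg)
    qed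
    have "\<pi> ` fst (func_ultrapower U) = c ` {f. spanning f}"
      unfolding func_ultrapower_def fst_conv image_image by (rule image_cong) (simp_all add: \<pi>_class)
    also have "\<dots> = fst (name_ultrapower enc U)"
    proof
      show "c ` {f. spanning f} \<subseteq> fst (name_ultrapower enc U)"
        using enc ultrafilter_top[OF U]
        by (auto simp: name_ultrapower_def c_def is_name_mixture val_in_ground_mixture)
      show "fst (name_ultrapower enc U) \<subseteq> c ` {f. spanning f}"
      proof
        fix X assume "X \<in> fst (name_ultrapower enc U)"
        then obtain \<tau> where \<tau>: "is_name enc \<tau>" "val_in_ground enc \<tau> \<in> U" "X = name_class enc U \<tau>"
          by (auto simp: name_ultrapower_def)
        obtain f where f: "spanning f" "val_in_ground enc \<tau> \<le> val_eq enc (mixture enc f) \<tau>"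
          using val_in_ground_le_val_eq_mixture[OF enc] by blast
        then have "name_eq enc U (mixture enc f) \<tau>"
          using ultrafilter_mono[OF U \<tau>(2)] by (simp add: name_eq_def)
        then have "X = c f"
          unfolding c_def \<tau>(3) using name_class_eq_iff[OF U is_name_mixture[OF enc]] by metis
        then show "X \<in> c ` {f. spanning f}" using f(1) by blast
      qed
    qed
    finally show "\<pi> ` fst (func_ultrapower U) = fst (name_ultrapower enc U)" .
  qed
  have mem: "snd (func_ultrapower U) X Y \<longleftrightarrow> snd (name_ultrapower enc U) (\<pi> X) (\<pi> Y)"
    if XY: "X \<in> fst (func_ultrapower U)" "Y \<in> fst (func_ultrapower U)" for X Y
  proof -
    obtain f g where fg: "spanning f" "spanning g" "X = func_class U f" "Y = func_class U g"
      using XY unfolding func_ultrapower_def fst_conv by blast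
    have mem_iff: "func_mem U f' g' \<longleftrightarrow> snd (name_ultrapower enc U) (c f') (c g')"
      if "spanning f'" "spanning g'" for f' g'
      using that unfolding c_def
      by (simp add: func_mem_iff_name_mem_mixture[OF enc] name_ultrapower_mem_iff[OF U] is_name_mixture[OF enc])
    have "snd (func_ultrapower U) X Y \<longleftrightarrow>
        (\<exists>f'\<in>func_class U f. \<exists>g'\<in>func_class U g. func_mem U f' g')"
      by (simp add: func_ultrapower_def fg)
    also have "\<dots> \<longleftrightarrow> snd (name_ultrapower enc U) (c f) (c g)"
    proof
      assume "\<exists>f'\<in>func_class U f. \<exists>g'\<in>func_class U g. func_mem U f' g'"
      then obtain f' g' where "f' \<in> func_class U f" "g' \<in> func_class U g" "func_mem U f' g'"
        by blast
      then show "snd (name_ultrapower enc U) (c f) (c g)"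
        using mem_iff[of f' g'] by (simp add: mem_class fg(1,2))
    next
      assume "snd (name_ultrapower enc U) (c f) (c g)"
      then have "func_mem U f g" using mem_iff fg(1,2) by blast
      moreover have "f \<in> func_class U f" "g \<in> func_class U g"
        by (simp_all add: mem_class fg(1,2))
      ultimately show "\<exists>f'\<in>func_class U f. \<exists>g'\<in>func_class U g. func_mem U f' g'"
        by blast
    qed
    finally show ?thesis by (simp add: fg \<pi>_class)
  qed
  have emb: "\<pi> (func_embedding U x) = name_embedding enc U x" for x
  proof -
    have "(top :: 'b) \<noteq> bot" using U by (auto simp: ultrafilter_def)
    then have "maximal_antichain {top :: 'b}"
      by (intro maximal_antichainI) (auto simp: antichain_def)
    then have f: "spanning [top :: 'b \<mapsto> x]" by (simp add: spanning_def)
    have "val_eq enc (mixture enc [top \<mapsto> x]) (check enc x) = top"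
      using le_val_eq_mixture_check[OF enc f, of top x] by (simp add: top_unique)
    then have "c [top \<mapsto> x] = name_class enc U (check enc x)"
      unfolding c_def using ultrafilter_top[OF U]
      by (simp add: name_class_eq_iff[OF U is_name_mixture[OF enc]] name_eq_def)
    then show ?thesis by (simp add: func_embedding_def name_embedding_def \<pi>_class[OF f])
  qed
  show ?thesis
    using bij mem emb by (intro exI[of _ \<pi>]) (simp add: isomorphism_def)
qed

end
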